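(* Let $n$ and $|S|$ be positive integers with $n-|S|\ge 2$. Let $\bar{L}$ be the $(n-|S|)\times(n-|S|)$ Laplacian matrix of a connected (undirected) graph on $n-|S|$ nodes, and let $\Delta=\mathrm{diag}(\alpha_1,\alpha_2,\ldots,\alpha_{n-|S|})$, where $0\le\alpha_i\le|S|$ for all $1\le i\le n-|S|$. Let $\mathbf{x}$ be the (elementwise) positive eigenvector corresponding to the smallest eigenvalue of $L_g=\bar{L}+\Delta$, normalized so that $\|\mathbf{x}\|_\infty=1$. Then the smallest element $x_{min}$ of $\mathbf{x}$ satisfies $$x_{min}\;\ge\;1-\frac{2\sqrt{|S|\,|\partial S|}}{\lambda_2(\bar{L})},$$ where $|\partial S|\triangleq\sum_{i=1}^{n-|S|}\alpha_i$.
   Context: Graphs are finite, simple and undirected; the Laplacian of a graph is the degree matrix minus the adjacency matrix. $\lambda_2(\bar{L})$ denotes the second smallest eigenvalue of $\bar{L}$ (counted with multiplicity), which is positive since the graph is connected. In the paper's setting $S$ is a set of grounded nodes in an $n$-node graph, $\bar{L}$ is the Laplacian of the graph obtained by deleting $S$ and all edges incident to $S$, $\alpha_i$ is the number of neighbors in $S$ of the $i$-th non-grounded node, and $|\partial S|$ is the number of edges between $S$ and its complement; in the lemma only the number $|S|$ and the $\alpha_i$ matter. *)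

theory Defs
  imports
    Complex_Main
    "Jordan_Normal_Form.Spectral_Radius"
    "Graph_Theory.Digraph_Component"
begin

text \<open>
  An undirected simple graph is a symmetric digraph without loops and multi-arcs
  (locale \<^locale>\<open>graph\<close>), so every undirected edge is a pair of opposite arcs and the degree of a
  vertex is its out-degree. The matrices below are meant for graphs with
  vertex set \<open>{0..<m}\<close>.
\<close>

definition degree_mat :: "nat \<Rightarrow> (nat, 'b) pre_digraph \<Rightarrow> real mat" where
  "degree_mat m G = mat_diag m (\<lambda>i. real (out_degree G i))"

definition adjacency_mat :: "nat \<Rightarrow> (nat, 'b) pre_digraph \<Rightarrow> real mat" where
  "adjacency_mat m G = Matrix.mat m m (\<lambda>(i, j). if (i, j) \<in> arcs_ends G then 1 else 0)"

definition laplacian_mat :: "nat \<Rightarrow> (nat, 'b) pre_digraph \<Rightarrow> real mat" where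
  "laplacian_mat m G = degree_mat m G - adjacency_mat m G"

definition smallest_eigenvalue :: "real mat \<Rightarrow> real" where
  "smallest_eigenvalue A = Min (spectrum A)"

text \<open>
  Roots of the characteristic polynomial, repeated according to multiplicity, in
  nondecreasing order. For a symmetric matrix this is the complete list of eigenvalues,
  since the characteristic polynomial then splits over the reals.
\<close>

definition sorted_eigenvalues :: "real mat \<Rightarrow> real list" where
  "sorted_eigenvalues A = sorted_list_of_multiset (proots (char_poly A))"

definition second_smallest_eigenvalue :: "real mat \<Rightarrow> real" where
  "second_smallest_eigenvalue A = sorted_eigenvalues A ! 1"

definition linf_norm :: "real vec \<Rightarrow> real" where
  "linf_norm x = Max (abs ` set\<^sub>v x)"

end

theory Submission
  imports Defs "HOL-Analysis.Function_Topology" "HOL-Analysis.Convex"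
begin

text \<open>
  Write \<open>m = n - s\<close>, let \<open>L\<close> be the Laplacian and \<open>\<Delta>\<close> the diagonal matrix of the \<open>\<alpha>\<^sub>i\<close>, put \<open>\<mu> = \<lambda>\<^sub>2(L)\<close>
  and let \<open>\<lambda>\<close> be the eigenvalue of the positive eigenvector \<open>x\<close>, so
  that \<open>L x = (\<lambda> - \<Delta>) x\<close>. Split \<open>x = c 1 + v\<close> with \<open>v\<close> orthogonal to the all-ones vector. Then
  \<open>L v = (\<lambda> - \<Delta>) x\<close>, and on the orthogonal complement of the all-ones vector
  \<open>\<mu> |v|\<^sup>2 \<le> \<langle>v, L v\<rangle>\<close>, so Cauchy-Schwarz gives \<open>\<mu> |v| \<le> |(\<lambda> - \<Delta>) x|\<close>: the eigenvector is nearly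
  constant when grounding is a small perturbation compared with the spectral gap. As \<open>0 < x\<^sub>i \<le> 1\<close>,
  \<open>|(\<lambda> - \<Delta>) x|\<^sup>2 \<le> m \<lambda>\<^sup>2 - 2 \<lambda> \<Sum>\<alpha>\<^sub>i + \<Sum>\<alpha>\<^sub>i\<^sup>2\<close>. This is at most \<open>\<Sum>\<alpha>\<^sub>i\<^sup>2 \<le> s \<Sum>\<alpha>\<^sub>i\<close> as soon as
  \<open>0 \<le> m \<lambda> \<le> \<Sum>\<alpha>\<^sub>i\<close>. The lower bound comes from summing the eigenvalue equation, the upper bound from
  dividing it by \<open>x\<^sub>i\<close> first, because \<open>\<Sum>(L x)\<^sub>i / x\<^sub>i \<le> 0\<close> for every positive \<open>x\<close>. Two entries of \<open>x\<close>
  differ by at most \<open>2 |v|\<close>, which is the claim (lemma \<open>spread_le_of_gap\<close>).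

  The remaining work is to see that the second entry of the sorted list of roots of the
  characteristic polynomial is positive and satisfies \<open>\<mu> |v|\<^sup>2 \<le> \<langle>v, L v\<rangle>\<close> for mean-zero \<open>v\<close> (lemma
  \<open>second_smallest_eigenvalue_laplacian\<close>). By compactness the Rayleigh quotient attains a
  minimum \<open>\<nu>\<close> over the mean-zero vectors, and a minimizer is an eigenvector for \<open>\<nu>\<close>; connectivity makes \<open>\<nu>\<close> positive. All roots are nonnegative since the energy is,
  and \<open>0\<close> is a root of multiplicity exactly one (lemma \<open>order_zero_char_poly_eq_1\<close>). Hence the list
  starts with a single \<open>0\<close>, its second entry is positive, and it is at most \<open>\<nu>\<close> because \<open>\<nu>\<close> occurs.
\<close>

section \<open>The Laplacian of a weighted graph as a quadratic form\<close>

definition lap :: "nat \<Rightarrow> (nat \<Rightarrow> nat \<Rightarrow> real) \<Rightarrow> (nat \<Rightarrow> real) \<Rightarrow> nat \<Rightarrow> real" where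
  "lap m a v i = (\<Sum>j<m. a i j * (v i - v j))"

locale weighted_graph =
  fixes m :: nat and a :: "nat \<Rightarrow> nat \<Rightarrow> real"
  assumes weight_sym: "i < m \<Longrightarrow> j < m \<Longrightarrow> a i j = a j i"
    and weight_nonneg: "i < m \<Longrightarrow> j < m \<Longrightarrow> 0 \<le> a i j"
begin

text \<open>
  Discrete Green identity. The symmetric right-hand side yields at once that the Laplacian is
  self-adjoint, has zero column sums and is positive semidefinite.
\<close>

lemma green_identity:
  "(\<Sum>i<m. u i * lap m a v i) = (\<Sum>i<m. \<Sum>j<m. a i j * ((u i - u j) * (v i - v j))) / 2"
proof -
  have e1: "(\<Sum>i<m. u i * lap m a v i) = (\<Sum>i<m. \<Sum>j<m. a i j * (u i * (v i - v j)))"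
    unfolding lap_def by (simp add: sum_distrib_left algebra_simps)
  also have "\<dots> = (\<Sum>j<m. \<Sum>i<m. a i j * (u i * (v i - v j)))"
    by (rule sum.swap)
  also have "\<dots> = (\<Sum>i<m. \<Sum>j<m. a i j * (- u j * (v i - v j)))"
    by (intro sum.cong refl) (simp add: weight_sym algebra_simps)
  finally have e2: "(\<Sum>i<m. u i * lap m a v i) = (\<Sum>i<m. \<Sum>j<m. a i j * (- u j * (v i - v j)))" .
  have "2 * (\<Sum>i<m. u i * lap m a v i) = (\<Sum>i<m. \<Sum>j<m. a i j * (u i * (v i - v j)))
      + (\<Sum>i<m. \<Sum>j<m. a i j * (- u j * (v i - v j)))"
    using e1 e2 by simp
  also have "\<dots> = (\<Sum>i<m. \<Sum>j<m. a i j * ((u i - u j) * (v i - v j)))"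
    unfolding sum.distrib[symmetric] by (intro sum.cong refl) (simp add: algebra_simps)
  finally show ?thesis by simp
qed

lemma lap_selfadjoint: "(\<Sum>i<m. u i * lap m a v i) = (\<Sum>i<m. v i * lap m a u i)"
  unfolding green_identity by (simp add: mult.commute)

lemma sum_lap: "(\<Sum>i<m. lap m a v i) = 0"
  using green_identity[of "\<lambda>_. 1" v] by simp

lemma energy_nonneg: "0 \<le> (\<Sum>i<m. v i * lap m a v i)"
  unfolding green_identity
  by (intro divide_nonneg_nonneg sum_nonneg mult_nonneg_nonneg[OF weight_nonneg zero_le_square]) auto

text \<open>
  By the Green identity applied to \<open>1 / x\<close> and \<open>x\<close>: every edge contributes
  \<open>(1 / x\<^sub>i - 1 / x\<^sub>j) (x\<^sub>i - x\<^sub>j) \<le> 0\<close>. For a positive solution of \<open>L x + \<Delta> x = \<lambda> x\<close>, where \<open>L\<close> is the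
  Laplacian on \<open>m\<close> nodes and \<open>\<Delta>\<close> the diagonal matrix of the \<open>\<alpha>\<^sub>i\<close>, this bounds \<open>m \<lambda>\<close> by \<open>\<Sum>\<alpha>\<^sub>i\<close>.
\<close>

lemma sum_lap_quotient_nonpos:
  assumes pos: "\<And>i. i < m \<Longrightarrow> 0 < x i"
  shows "(\<Sum>i<m. lap m a x i / x i) \<le> 0"
proof -
  have "(1 / s - 1 / t) * (s - t) \<le> 0" if "0 < s" "0 < t" for s t :: real
  proof -
    have "(1 / s - 1 / t) * (s - t) = - ((s - t)\<^sup>2 / (s * t))"
      using that by (simp add: field_simps power2_eq_square)
    then show ?thesis using that by simp
  qed
  then have "a i j * ((1 / x i - 1 / x j) * (x i - x j)) \<le> 0" if "i < m" "j < m" for i j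
    using that pos weight_nonneg by (simp add: mult_nonneg_nonpos)
  then have "(\<Sum>i<m. \<Sum>j<m. a i j * ((1 / x i - 1 / x j) * (x i - x j))) \<le> 0"
    by (intro sum_nonpos) auto
  then show ?thesis using green_identity[of "\<lambda>i. 1 / x i" x] by simp
qed

section \<open>The spread of a grounded eigenvector\<close>

text \<open>
  The analytic core, for any lower bound \<open>\<mu>\<close> of the Rayleigh quotient on mean-zero vectors. The
  deviation of \<open>x\<close> from its mean is controlled by the residual \<open>(\<lambda> - \<Delta>) x\<close>, whose squared norm is at
  most \<open>s \<Sum>\<alpha>\<^sub>i\<close> because \<open>0 \<le> m \<lambda> \<le> \<Sum>\<alpha>\<^sub>i\<close>.
\<close>

lemma spread_le_of_gap:
  fixes \<mu> lam s :: real
  assumes gap: "\<And>v. (\<Sum>i<m. v i) = 0 \<Longrightarrow> \<mu> * (\<Sum>i<m. (v i)\<^sup>2) \<le> (\<Sum>i<m. v i * lap m a v i)"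
    and mu: "0 < \<mu>"
    and eig: "\<And>i. i < m \<Longrightarrow> lap m a x i + \<alpha> i * x i = lam * x i"
    and pos: "\<And>i. i < m \<Longrightarrow> 0 < x i" and le1: "\<And>i. i < m \<Longrightarrow> x i \<le> 1"
    and al0: "\<And>i. i < m \<Longrightarrow> 0 \<le> \<alpha> i" and als: "\<And>i. i < m \<Longrightarrow> \<alpha> i \<le> s"
    and k: "k < m" and l: "l < m"
  shows "x k - x l \<le> 2 * sqrt (s * (\<Sum>i<m. \<alpha> i)) / \<mu>"
proof -
  define A where "A = (\<Sum>i<m. \<alpha> i)"
  have m: "0 < m" using k by simp
  have X: "0 < (\<Sum>i<m. x i)" using m pos by (intro sum_pos) auto
  have "(\<Sum>i<m. \<alpha> i * x i) = (\<Sum>i<m. lam * x i - lap m a x i)"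
    by (rule sum.cong) (use eig in \<open>auto simp: algebra_simps\<close>)
  also have "\<dots> = lam * (\<Sum>i<m. x i)"
    by (simp add: sum_subtractf sum_lap sum_distrib_left)
  finally have "lam * (\<Sum>i<m. x i) \<ge> 0"
    using al0 pos by (metis (no_types, lifting) lessThan_iff less_imp_le mult_nonneg_nonneg sum_nonneg)
  then have lam0: "0 \<le> lam" using X by (simp add: zero_le_mult_iff)
  have "real m * lam = (\<Sum>i<m. lap m a x i / x i + \<alpha> i)"
  proof -
    have "lap m a x i / x i + \<alpha> i = lam" if "i < m" for i
      using eig[OF that] pos[OF that] by (simp add: field_simps)
    then show ?thesis by simp
  qed
  then have lamA: "real m * lam \<le> A"
    using sum_lap_quotient_nonpos[of x, OF pos] by (simp add: sum.distrib A_def)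
  define v where "v = (\<lambda>i. x i - (\<Sum>i<m. x i) / real m)"
  have v0: "(\<Sum>i<m. v i) = 0" using m by (simp add: v_def sum_subtractf)
  have lapv: "lap m a v i = lap m a x i" for i by (simp add: lap_def v_def)
  define V where "V = (\<Sum>i<m. (v i)\<^sup>2)"
  define R where "R = (\<Sum>i<m. ((lam - \<alpha> i) * x i)\<^sup>2)"
  have "\<mu> * V \<le> (\<Sum>i<m. v i * ((lam - \<alpha> i) * x i))"
  proof -
    have "lap m a v i = (lam - \<alpha> i) * x i" if "i < m" for i
      using eig[OF that] unfolding lapv left_diff_distrib by linarith
    then have "(\<Sum>i<m. v i * lap m a v i) = (\<Sum>i<m. v i * ((lam - \<alpha> i) * x i))"
      by simp
    then show ?thesis using gap[OF v0] by (simp add: V_def)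
  qed
  moreover have V0: "0 \<le> V" by (simp add: V_def sum_nonneg)
  moreover have "(\<Sum>i<m. v i * ((lam - \<alpha> i) * x i))\<^sup>2 \<le> V * R"
    unfolding V_def R_def by (rule Cauchy_Schwarz_ineq_sum)
  ultimately have "(\<mu> * V)\<^sup>2 \<le> V * R"
    using mu by (smt (verit) power_mono mult_nonneg_nonneg)
  have "R \<ge> 0" by (simp add: R_def sum_nonneg)
  \<comment> \<open>Cancel one factor \<open>V\<close> without dividing by zero when \<open>x\<close> is constant.\<close>
  have "\<mu>\<^sup>2 * V \<le> R"
  proof (cases "V = 0")
    case False
    then have "V * (\<mu>\<^sup>2 * V) \<le> V * R" using \<open>(\<mu> * V)\<^sup>2 \<le> V * R\<close>
      by (simp add: power2_eq_square algebra_simps)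
    then show ?thesis using False V0 by simp
  qed (use \<open>R \<ge> 0\<close> in simp)
  have "R \<le> (\<Sum>i<m. (lam - \<alpha> i)\<^sup>2)"
    unfolding R_def power_mult_distrib
    by (intro sum_mono mult_left_le) (auto intro!: power_le_one less_imp_le[OF pos] le1)
  also have "\<dots> = real m * lam * lam - 2 * lam * A + (\<Sum>i<m. \<alpha> i * \<alpha> i)"
  proof -
    have "(lam - \<alpha> i)\<^sup>2 = lam * lam - 2 * lam * \<alpha> i + \<alpha> i * \<alpha> i" for i
      by (simp add: power2_eq_square algebra_simps)
    then show ?thesis
      by (simp add: sum.distrib sum_subtractf A_def sum_distrib_left[symmetric])
  qed
  also have "\<dots> \<le> (\<Sum>i<m. \<alpha> i * \<alpha> i)"
  proof -
    have "real m * lam * lam \<le> A * lam" by (rule mult_right_mono[OF lamA lam0])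
    moreover have "0 \<le> A * lam" using lam0 al0 by (auto simp: A_def intro!: mult_nonneg_nonneg sum_nonneg)
    ultimately show ?thesis by (simp add: algebra_simps)
  qed
  also have "\<dots> \<le> (\<Sum>i<m. s * \<alpha> i)"
    by (intro sum_mono mult_right_mono) (auto intro: al0 als)
  finally have "R \<le> s * A" by (simp add: A_def sum_distrib_left)
  with \<open>\<mu>\<^sup>2 * V \<le> R\<close> have "sqrt (\<mu>\<^sup>2 * V) \<le> sqrt (s * A)" by simp
  then have "sqrt V \<le> sqrt (s * A) / \<mu>"
    using mu by (simp add: real_sqrt_mult field_simps)
  moreover have "\<bar>v i\<bar> \<le> sqrt V" if "i < m" for i
  proof -
    have "(v i)\<^sup>2 \<le> V" unfolding V_def by (rule member_le_sum) (use that in auto)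
    then show ?thesis by (metis real_sqrt_abs real_sqrt_le_iff)
  qed
  from this[OF k] this[OF l] have "v k - v l \<le> 2 * sqrt V" by linarith
  ultimately show ?thesis by (simp add: v_def A_def)
qed

section \<open>Minimizing the Rayleigh quotient over mean-zero vectors\<close>

text \<open>
  The unit sphere of mean-zero vectors is compact. Vectors are represented as functions on all of
  \<open>nat\<close>, so the coordinates beyond \<open>m\<close> are pinned to \<open>0\<close> and compactness is that of a product of compact
  sets.
\<close>

lemma rayleigh_minimizer_exists:
  assumes m: "2 \<le> m"
  obtains w where "(\<Sum>i<m. w i) = 0" "(\<Sum>i<m. (w i)\<^sup>2) = 1"
    "\<And>v. (\<Sum>i<m. v i) = 0 \<Longrightarrow>
      (\<Sum>i<m. w i * lap m a w i) * (\<Sum>i<m. (v i)\<^sup>2) \<le> (\<Sum>i<m. v i * lap m a v i)"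
proof -
  define Q where "Q = (\<lambda>v. \<Sum>i<m. v i * lap m a v i)"
  define B :: "(nat \<Rightarrow> real) set" where "B = (\<Pi>\<^sub>E i\<in>UNIV. if i < m then {-1..1} else {0})"
  define C where "C = B \<inter> {v. (\<Sum>i<m. v i) = 0} \<inter> {v. (\<Sum>i<m. (v i)\<^sup>2) = 1}"
  have "compactin (product_topology (\<lambda>i::nat. euclidean) UNIV) B"
    unfolding B_def by (subst compactin_PiE) auto
  then have "compact B" by (simp add: euclidean_product_topology)
  have cont: "continuous_on UNIV (\<lambda>v :: nat \<Rightarrow> real. v i)" for i
    by (rule continuous_on_product_coordinates)
  have "compact C" unfolding C_def
    by (intro compact_Int_closed \<open>compact B\<close> closed_Collect_eq continuous_intros cont)
  moreover have "C \<noteq> {}"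
  proof -
    \<comment> \<open>Two coordinates suffice for a mean-zero unit vector; this is where \<open>2 \<le> m\<close> enters.\<close>
    define c :: real where "c = 1 / sqrt 2"
    have c: "0 \<le> c" "c \<le> 1" "c\<^sup>2 + c\<^sup>2 = 1" by (simp_all add: c_def power_divide)
    define u where "u = (\<lambda>i::nat. if i = 0 then c else if i = 1 then - c else 0)"
    have split: "{..<m} = insert 0 (insert 1 {2..<m})" using m by auto
    have "(\<Sum>i<m. u i) = 0" "(\<Sum>i<m. (u i)\<^sup>2) = 1"
      unfolding split using c by (auto simp: u_def)
    moreover have "u \<in> B" using c m by (auto simp: B_def u_def PiE_def)
    ultimately show ?thesis by (auto simp: C_def)
  qed
  moreover have "continuous_on C Q"
    unfolding Q_def lap_def by (intro continuous_intros continuous_on_subset[OF cont]) auto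
  ultimately have "\<exists>w\<in>C. \<forall>v\<in>C. Q w \<le> Q v" by (rule continuous_attains_inf)
  then obtain w where w: "w \<in> C" and min: "\<And>v. v \<in> C \<Longrightarrow> Q w \<le> Q v" by blast
  have "Q w * (\<Sum>i<m. (v i)\<^sup>2) \<le> Q v" if v: "(\<Sum>i<m. v i) = 0" for v
  proof (cases "(\<Sum>i<m. (v i)\<^sup>2) = 0")
    case True
    then have "v i = 0" if "i < m" for i
      using that by (subst (asm) sum_nonneg_eq_0_iff) auto
    then show ?thesis using True by (simp add: Q_def)
  next
    case False
    define V where "V = (\<Sum>i<m. (v i)\<^sup>2)"
    have V: "0 < V" using False by (simp add: V_def sum_nonneg order_less_le)
    define u where "u = (\<lambda>i. if i < m then v i / sqrt V else 0)"
    have "(\<Sum>i<m. u i) = 0" using v by (simp add: u_def sum_divide_distrib[symmetric])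
    moreover have u1: "(\<Sum>i<m. (u i)\<^sup>2) = 1"
      using V by (simp add: u_def power_divide sum_divide_distrib[symmetric]) (simp add: V_def)
    moreover have "u \<in> B"
    proof -
      have "\<bar>u i\<bar> \<le> 1" if "i < m" for i
      proof -
        have "(u i)\<^sup>2 \<le> 1" unfolding u1[symmetric] by (rule member_le_sum) (use that in auto)
        then show ?thesis by (simp add: abs_square_le_1)
      qed
      then have "- 1 \<le> u i \<and> u i \<le> 1" if "i < m" for i
        using that by (simp add: abs_le_iff minus_le_iff)
      moreover have "u i = 0" if "\<not> i < m" for i using that by (simp add: u_def)
      ultimately show ?thesis by (auto simp: B_def PiE_def)
    qed
    ultimately have "Q w \<le> Q u" by (intro min) (simp add: C_def)
    also have "Q u = Q v / V"
    proof -
      have "u i * lap m a u i = v i * lap m a v i / V" if "i < m" for i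
      proof -
        have "lap m a u i = lap m a v i / sqrt V"
          using that by (simp add: lap_def u_def sum_divide_distrib diff_divide_distrib[symmetric])
        then show ?thesis using that V by (simp add: u_def)
      qed
      then show ?thesis by (simp add: Q_def sum_divide_distrib)
    qed
    finally show ?thesis using V by (simp add: V_def[symmetric] field_simps)
  qed
  with w that show ?thesis by (auto simp: C_def Q_def)
qed

text \<open>
  First variation. The residual \<open>d = L w - \<mu> w\<close>, with \<open>L\<close> the Laplacian, is itself mean-zero, hence an
  admissible direction. Along \<open>w + t d\<close> the functional \<open>\<langle>v, L v\<rangle> - \<mu> |v|\<^sup>2\<close> has minimum \<open>0\<close> at \<open>t = 0\<close>,
  and its derivative there is \<open>2 |d|\<^sup>2\<close>.
\<close>

lemma rayleigh_minimizer_eigenvector: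
  assumes w: "(\<Sum>i<m. w i) = 0"
    and mu: "(\<Sum>i<m. w i * lap m a w i) = \<mu> * (\<Sum>i<m. (w i)\<^sup>2)"
    and min: "\<And>v. (\<Sum>i<m. v i) = 0 \<Longrightarrow> \<mu> * (\<Sum>i<m. (v i)\<^sup>2) \<le> (\<Sum>i<m. v i * lap m a v i)"
    and k: "k < m"
  shows "lap m a w k = \<mu> * w k"
proof -
  define d where "d = (\<lambda>i. lap m a w i - \<mu> * w i)"
  define D where "D = (\<Sum>i<m. (d i)\<^sup>2)"
  define E where "E = (\<Sum>i<m. d i * lap m a d i) - \<mu> * D"
  have d0: "(\<Sum>i<m. d i) = 0"
    by (simp add: d_def sum_subtractf sum_lap sum_distrib_left[symmetric] w)
  have quad: "0 \<le> 2 * t * D + t\<^sup>2 * E" for t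
  proof -
    define v where "v = (\<lambda>i. w i + t * d i)"
    have "(\<Sum>i<m. v i) = 0" using w d0 by (simp add: v_def sum.distrib sum_distrib_left[symmetric])
    note le = min[OF this]
    have lapv: "lap m a v i = lap m a w i + t * lap m a d i" for i
      by (simp add: lap_def v_def sum.distrib[symmetric] sum_distrib_left algebra_simps)
    have "v i * lap m a v i = w i * lap m a w i + (t * (w i * lap m a d i)
        + (t * (d i * lap m a w i) + t\<^sup>2 * (d i * lap m a d i)))" for i
      unfolding lapv by (simp add: v_def algebra_simps power2_eq_square)
    then have e1: "(\<Sum>i<m. v i * lap m a v i) = (\<Sum>i<m. w i * lap m a w i)
        + 2 * t * (\<Sum>i<m. d i * lap m a w i) + t\<^sup>2 * (\<Sum>i<m. d i * lap m a d i)"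
      by (simp add: sum.distrib sum_distrib_left[symmetric] lap_selfadjoint[of w d])
    have "(v i)\<^sup>2 = (w i)\<^sup>2 + (2 * t * (d i * w i) + t\<^sup>2 * (d i)\<^sup>2)" for i
      by (simp add: v_def algebra_simps power2_eq_square)
    then have e2: "(\<Sum>i<m. (v i)\<^sup>2) = (\<Sum>i<m. (w i)\<^sup>2)
        + 2 * t * (\<Sum>i<m. d i * w i) + t\<^sup>2 * D"
      by (simp add: D_def sum.distrib sum_distrib_left[symmetric])
    have "(d i)\<^sup>2 = d i * lap m a w i - \<mu> * (d i * w i)" for i
      by (simp add: d_def algebra_simps power2_eq_square)
    then have e3: "(\<Sum>i<m. d i * lap m a w i) - \<mu> * (\<Sum>i<m. d i * w i) = D"
      by (simp add: D_def sum_subtractf sum_distrib_left[symmetric])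
    have "2 * t * D + t\<^sup>2 * E = (\<Sum>i<m. v i * lap m a v i) - \<mu> * (\<Sum>i<m. (v i)\<^sup>2)"
      unfolding e1 e2 mu E_def e3[symmetric] by (simp add: algebra_simps)
    then show ?thesis using le by simp
  qed
  have "D \<le> 0"
  proof (rule ccontr)
    assume "\<not> D \<le> 0"
    then have D: "0 < D" by simp
    \<comment> \<open>A step against the slope, short enough that the quadratic term cannot compensate.\<close>
    define t where "t = - D / (\<bar>E\<bar> + 1)"
    have t: "t < 0" using D by (simp add: t_def)
    have "0 \<le> t * (2 * D + t * E)" using quad[of t] by (simp add: algebra_simps power2_eq_square)
    then have "2 * D + t * E \<le> 0" using t by (simp add: zero_le_mult_iff)
    moreover have "t * E \<ge> - D"
    proof -
      have "- (t * E) = D * (E / (\<bar>E\<bar> + 1))" by (simp add: t_def)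
      also have "\<dots> \<le> D * 1" using D by (intro mult_left_mono) (auto simp: field_simps)
      finally show ?thesis by simp
    qed
    ultimately show False using D by simp
  qed
  then have "D = 0" by (simp add: D_def sum_nonneg order_antisym)
  then have "d k = 0" using k unfolding D_def by (subst (asm) sum_nonneg_eq_0_iff) auto
  then show ?thesis by (simp add: d_def)
qed

end

section \<open>Vectors of zero energy on a connected graph\<close>

text \<open>
  Connectivity enters only through potentials: a function that agrees across every edge is constant.
\<close>

locale connected_weighted_graph = weighted_graph +
  assumes constant_if_locally_constant:
    "(\<And>i j. i < m \<Longrightarrow> j < m \<Longrightarrow> a i j \<noteq> 0 \<Longrightarrow> v i = v j) \<Longrightarrow> k < m \<Longrightarrow> l < m \<Longrightarrow> v k = (v l :: real)"
begin

lemma zero_energy_imp_constant: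
  assumes "(\<Sum>i<m. v i * lap m a v i) = 0" "k < m" "l < m"
  shows "v k = v l"
proof (rule constant_if_locally_constant[OF _ assms(2,3)])
  fix i j assume ij: "i < m" "j < m" and nz: "a i j \<noteq> 0"
  have "(\<Sum>i<m. \<Sum>j<m. a i j * ((v i - v j) * (v i - v j))) = 0"
    using assms(1) unfolding green_identity by simp
  moreover have nn: "0 \<le> a i j * ((v i - v j) * (v i - v j))" if "i < m" "j < m" for i j
    using that weight_nonneg by simp
  ultimately have "(\<Sum>j<m. a i j * ((v i - v j) * (v i - v j))) = 0"
    using ij by (subst (asm) sum_nonneg_eq_0_iff) (auto intro!: sum_nonneg)
  then have "a i j * ((v i - v j) * (v i - v j)) = 0"
    using ij nn by (subst (asm) sum_nonneg_eq_0_iff) auto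
  then show "v i = v j" using nz by simp
qed

lemma zero_energy_mean_zero_imp_zero:
  assumes "(\<Sum>i<m. v i * lap m a v i) = 0" "(\<Sum>i<m. v i) = 0" "k < m"
  shows "v k = 0"
proof -
  have "(\<Sum>i<m. v i) = (\<Sum>i<m. v k)"
    by (rule sum.cong) (use zero_energy_imp_constant assms in auto)
  then show ?thesis using assms by simp
qed

end

section \<open>Simplicity of the root zero\<close>

text \<open>
  For a general matrix the algebraic multiplicity of an eigenvalue can exceed the geometric one. Here
  the zero column sums settle it: adding all rows of \<open>X I - A\<close> to the first one turns that row into
  \<open>(X, \<dots>, X)\<close>, so the characteristic polynomial is \<open>X\<close> times the determinant of the matrix \<open>N\<close> whose
  first row consists of ones. At \<open>X = 0\<close> this matrix is invertible: a vector in its kernel has entries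
  summing to \<open>0\<close> and is annihilated by all rows of \<open>A\<close> but the first, hence by the first one as well,
  the rows of \<open>A\<close> having sum \<open>0\<close>.
\<close>

lemma order_zero_char_poly_eq_1:
  fixes A :: "'a :: field mat"
  assumes A: "A \<in> carrier_mat m m" and m: "0 < m"
    and colsum: "\<And>j. j < m \<Longrightarrow> (\<Sum>i<m. A $$ (i, j)) = 0"
    and kernel: "\<And>w. w \<in> carrier_vec m \<Longrightarrow> A *\<^sub>v w = 0\<^sub>v m \<Longrightarrow> (\<Sum>i<m. w $ i) = 0 \<Longrightarrow> w = 0\<^sub>v m"
  shows "order 0 (char_poly A) = 1"
proof -
  define C where "C = char_poly_matrix A"
  define P :: "'a poly mat" where "P = Matrix.mat m m (\<lambda>(i, j). if i = 0 \<or> i = j then 1 else 0)"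
  define N :: "'a poly mat" where "N = Matrix.mat m m (\<lambda>(i, j). if i = 0 then 1 else C $$ (i, j))"
  define N0 :: "'a mat" where "N0 = Matrix.mat m m (\<lambda>(i, j). if i = 0 then 1 else - A $$ (i, j))"
  have car [simp]: "C \<in> carrier_mat m m" "P \<in> carrier_mat m m" "N \<in> carrier_mat m m" "N0 \<in> carrier_mat m m"
    using A by (auto simp: C_def P_def N_def N0_def)
  have C_entry: "C $$ (i, j) = (if i = j then [:0, 1:] else 0) + [:- A $$ (i, j):]" if "i < m" "j < m" for i j
    using that A by (auto simp: C_def char_poly_matrix_def)
  have C_colsum: "(\<Sum>i<m. C $$ (i, j)) = [:0, 1:]" if j: "j < m" for j
  proof -
    have "(\<Sum>i<m. C $$ (i, j)) = (\<Sum>i<m. (if i = j then [:0, 1:] else 0) + [:- A $$ (i, j):])"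
      by (rule sum.cong) (use j C_entry in auto)
    also have "\<dots> = [:0, 1:] + (\<Sum>i<m. [:- A $$ (i, j):])"
      using j by (simp add: sum.distrib)
    also have "(\<Sum>i<m. [:- A $$ (i, j):]) = [:\<Sum>i<m. - A $$ (i, j):]"
      by (induction m) auto
    finally show ?thesis using colsum[OF j] by (simp add: sum_negf)
  qed
  \<comment> \<open>Multiplication by \<open>P\<close> adds all other rows to the first one.\<close>
  have "P * C = multrow 0 [:0, 1:] N"
  proof (rule eq_matI)
    fix i j assume "i < dim_row (multrow 0 [:0, 1:] N)" "j < dim_col (multrow 0 [:0, 1:] N)"
    then have ij: "i < m" "j < m" by (auto simp: N_def)
    have dims: "dim_row C = m" "dim_col C = m" using carrier_matD[OF car(1)] by blast+
    have "(P * C) $$ (i, j) = (\<Sum>k<m. (if i = 0 \<or> i = k then 1 else 0) * C $$ (k, j))"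
      using ij dims by (simp add: P_def scalar_prod_def lessThan_atLeast0)
    also have "\<dots> = (if i = 0 then [:0, 1:] else C $$ (i, j))"
    proof (cases "i = 0")
      case False
      have "(\<Sum>k<m. (if i = 0 \<or> i = k then 1 else 0) * C $$ (k, j)) = (\<Sum>k<m. if i = k then C $$ (k, j) else 0)"
        by (rule sum.cong) (use False in auto)
      then show ?thesis using False ij by simp
    qed (use ij C_colsum in simp)
    also have "\<dots> = multrow 0 [:0, 1:] N $$ (i, j)"
      using ij by (simp add: N_def)
    finally show "(P * C) $$ (i, j) = multrow 0 [:0, 1:] N $$ (i, j)" .
  qed (use carrier_matD[OF car(1)] in \<open>simp_all add: P_def N_def\<close>)
  moreover have "det P = 1"
  proof -
    have "upper_triangular P" by (auto simp: P_def upper_triangular_def)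
    then have "det P = prod_list (diag_mat P)" by (rule det_upper_triangular[OF _ car(2)])
    also have "diag_mat P = map (\<lambda>_. 1) [0..<m]" by (auto simp: diag_mat_def P_def)
    also have "prod_list \<dots> = 1" by (induction m) auto
    finally show ?thesis .
  qed
  ultimately have fact: "char_poly A = [:0, 1:] * det N"
    using det_mult[of P m C] det_multrow[OF m, of N "[:0, 1:]"] by (simp add: char_poly_def C_def[symmetric])
  have "poly (det N) 0 = det N0"
    by (rule poly_det_cong[of _ m]) (auto simp: N_def N0_def C_entry)
  moreover have "det N0 \<noteq> 0"
  proof
    assume "det N0 = 0"
    then obtain w where w: "w \<in> carrier_vec m" "w \<noteq> 0\<^sub>v m" "N0 *\<^sub>v w = 0\<^sub>v m"
      using det_0_iff_vec_prod_zero_field[of N0 m] by auto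
    have row: "(\<Sum>j<m. N0 $$ (i, j) * w $ j) = 0" if "i < m" for i
    proof -
      have "(N0 *\<^sub>v w) $ i = (\<Sum>j<m. N0 $$ (i, j) * w $ j)"
        using that w(1) by (simp add: N0_def scalar_prod_def lessThan_atLeast0)
      then show ?thesis using w(3) that by simp
    qed
    have sum0: "(\<Sum>j<m. w $ j) = 0" using row[OF m] m by (simp add: N0_def)
    define b where "b = (\<lambda>i. \<Sum>j<m. A $$ (i, j) * w $ j)"
    have b: "b i = 0" if "i < m" "i \<noteq> 0" for i
      using row[OF that(1)] that by (simp add: N0_def b_def sum_negf)
    have "(\<Sum>i<m. b i) = (\<Sum>j<m. (\<Sum>i<m. A $$ (i, j)) * w $ j)"
      unfolding b_def sum_distrib_right by (rule sum.swap)
    also have "\<dots> = 0" by (simp add: colsum)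
    finally have "(\<Sum>i<m. b i) = 0" .
    moreover have "(\<Sum>i<m. b i) = b 0"
      using m b by (subst sum.remove[of _ 0]) auto
    ultimately have b0: "b i = 0" if "i < m" for i
      using b that by (cases "i = 0") auto
    have "A *\<^sub>v w = 0\<^sub>v m"
    proof (rule eq_vecI)
      fix i assume "i < dim_vec (0\<^sub>v m :: 'a vec)"
      then have "(A *\<^sub>v w) $ i = b i"
        using A w(1) by (auto simp: b_def scalar_prod_def lessThan_atLeast0 intro!: sum.cong)
      then show "(A *\<^sub>v w) $ i = 0\<^sub>v m $ i" using b0 \<open>i < dim_vec (0\<^sub>v m :: 'a vec)\<close> by simp
    qed (use A in auto)
    then show False using kernel w sum0 by blast
  qed
  ultimately have nz: "poly (det N) 0 \<noteq> 0" by simp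
  then have "order 0 (det N) = 0" by (rule order_0I)
  moreover have "order 0 ([:0, 1:] :: 'a poly) = 1"
    using order_power_n_n[of 0 1] by simp
  moreover have "[:0, 1:] * det N \<noteq> 0" using nz by auto
  ultimately show ?thesis unfolding fact using Polynomial.order_mult[of "[:0, 1:]" "det N" 0] by linarith
qed

text \<open>
  This turns the multiplicity of the root \<open>0\<close> into a statement about position \<open>1\<close> of the sorted list
  of roots: a single \<open>0\<close> occupies position \<open>0\<close>.
\<close>

lemma second_of_sorted_list_of_multiset:
  fixes M :: "'a :: {linorder, zero} multiset"
  assumes nonneg: "\<And>y. y \<in># M \<Longrightarrow> 0 \<le> y" and simple: "count M 0 = 1"
    and x: "x \<in># M" "0 < x"
  shows "0 < sorted_list_of_multiset M ! 1" "sorted_list_of_multiset M ! 1 \<le> x"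
proof -
  define xs where "xs = sorted_list_of_multiset M"
  have xs: "sorted xs" "mset xs = M" "set xs = set_mset M" by (simp_all add: xs_def)
  obtain y ys where yys: "xs = y # ys" using xs(3) x(1) by (cases xs) auto
  have set_M: "set_mset M = insert y (set ys)" using xs(3) yys by simp
  have "0 \<in># M" using simple by (simp add: count_greater_zero_iff[symmetric])
  moreover have "\<forall>z\<in>set ys. y \<le> z" using xs(1) yys by simp
  ultimately have "y \<le> 0" using set_M by auto
  moreover have "0 \<le> y" using set_M nonneg by blast
  ultimately have y: "y = 0" by simp
  have "count (add_mset y (mset ys)) 0 = 1" using simple xs(2) yys by simp
  then have zys: "0 \<notin> set ys" using y by simp
  have xys: "x \<in> set ys" using x y by (auto simp: set_M)
  then obtain z zs where zzs: "ys = z # zs" by (cases ys) auto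
  have "z \<le> x" using xs(1) xys unfolding yys zzs by auto
  moreover have "0 \<le> z" using set_M zzs nonneg by simp
  then have "0 < z" using zys zzs by (metis list.set_intros(1) order_le_less)
  ultimately show "0 < sorted_list_of_multiset M ! 1" "sorted_list_of_multiset M ! 1 \<le> x"
    unfolding xs_def[symmetric] yys zzs by auto
qed

section \<open>From graphs to weights\<close>

definition adjacency :: "(nat, 'b) pre_digraph \<Rightarrow> nat \<Rightarrow> nat \<Rightarrow> real" where
  "adjacency G i j = (if (i, j) \<in> arcs_ends G then 1 else 0)"

lemma laplacian_mat_carrier [simp]: "laplacian_mat m G \<in> carrier_mat m m"
  unfolding laplacian_mat_def degree_mat_def adjacency_mat_def by auto

text \<open>
  The out-degree counts arcs and the row sum counts neighbours; they agree because there are no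
  parallel arcs.
\<close>

lemma out_degree_eq_sum_adjacency:
  assumes "Digraph.graph G" and V: "verts G = {0..<m}"
  shows "real (out_degree G i) = (\<Sum>j<m. adjacency G i j)"
proof -
  interpret graph G by fact
  have "inj_on (head G) (out_arcs G i)"
    by (rule inj_onI) (auto intro!: no_multi_arcs simp: arc_to_ends_def)
  then have "card (out_arcs G i) = card (head G ` out_arcs G i)" by (simp add: card_image)
  also have "head G ` out_arcs G i = {j \<in> {..<m}. (i, j) \<in> arcs_ends G}"
    using head_in_verts V by (auto simp: arcs_ends_conv)
  finally show ?thesis
    by (simp add: out_degree_def adjacency_def sum.If_cases Int_def)
qed

lemma laplacian_mat_mult_vec:
  assumes G: "Digraph.graph G" "verts G = {0..<m}" and v: "v \<in> carrier_vec m" and i: "i < m"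
  shows "(laplacian_mat m G *\<^sub>v v) $ i = lap m (adjacency G) (\<lambda>i. v $ i) i"
proof -
  have "(laplacian_mat m G *\<^sub>v v) $ i =
      (\<Sum>j<m. ((if i = j then real (out_degree G i) else 0) - adjacency G i j) * v $ j)"
    using v i by (auto simp: laplacian_mat_def degree_mat_def adjacency_mat_def adjacency_def mat_diag_def
        scalar_prod_def lessThan_atLeast0 intro!: sum.cong)
  also have "\<dots> = (\<Sum>j<m. (if i = j then real (out_degree G i) * v $ j else 0) - adjacency G i j * v $ j)"
    by (rule sum.cong) (auto simp: algebra_simps)
  also have "\<dots> = real (out_degree G i) * v $ i - (\<Sum>j<m. adjacency G i j * v $ j)"
    using i by (simp add: sum_subtractf)
  also have "\<dots> = lap m (adjacency G) (\<lambda>i. v $ i) i"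
    unfolding out_degree_eq_sum_adjacency[OF G] lap_def
    by (simp add: sum_distrib_right sum_subtractf right_diff_distrib)
  finally show ?thesis .
qed

lemma connected_weighted_graph_adjacency:
  assumes "Digraph.graph G" "verts G = {0..<m}" "Digraph_Component.connected G"
  shows "connected_weighted_graph m (adjacency G)"
proof -
  interpret graph G by fact
  have sym: "(i, j) \<in> arcs_ends G \<longleftrightarrow> (j, i) \<in> arcs_ends G" for i j
    by (rule iffI; erule arcs_ends_symmetric[OF sym_arcs])
  show ?thesis
  proof
    fix v :: "nat \<Rightarrow> real" and k l
    assume loc: "\<And>i j. i < m \<Longrightarrow> j < m \<Longrightarrow> adjacency G i j \<noteq> 0 \<Longrightarrow> v i = v j" and kl: "k < m" "l < m"
    have "k \<rightarrow>\<^sup>*\<^bsub>mk_symmetric G\<^esub> l"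
      using assms(2,3) kl by (auto simp: connected_def strongly_connected_def)
    then have "k \<rightarrow>\<^sup>*\<^bsub>G\<^esub> l" by (simp add: reachable_mk_symmetric_eq sym_arcs)
    then show "v k = v l"
    proof (induction rule: reachable_induct)
      case (step x y)
      then have "x < m" "y < m" using adj_in_verts[of x y] assms(2) by auto
      then show ?case using loc[of x y] step by (simp add: adjacency_def)
    qed simp
  qed (auto simp: adjacency_def sym)
qed

section \<open>The second smallest Laplacian eigenvalue\<close>

text \<open>
  The variational characterization of \<open>\<lambda>\<^sub>2\<close>. The inequality is proved for the minimum of the Rayleigh
  quotient over the mean-zero vectors, which is a positive root of the characteristic polynomial and
  therefore an upper bound for the second root.
\<close>

lemma second_smallest_eigenvalue_laplacian:
  assumes m: "2 \<le> m" and G: "Digraph.graph G" "verts G = {0..<m}" "Digraph_Component.connected G"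
  defines "\<mu> \<equiv> second_smallest_eigenvalue (laplacian_mat m G)"
  shows "0 < \<mu>"
    and "(\<Sum>i<m. v i) = 0 \<Longrightarrow> \<mu> * (\<Sum>i<m. (v i)\<^sup>2) \<le> (\<Sum>i<m. v i * lap m (adjacency G) v i)"
proof -
  interpret connected_weighted_graph m "adjacency G"
    by (rule connected_weighted_graph_adjacency[OF G])
  define L where "L = laplacian_mat m G"
  have L [simp]: "L \<in> carrier_mat m m" by (simp add: L_def)
  have L_mult: "(L *\<^sub>v u) $ i = lap m (adjacency G) (\<lambda>i. u $ i) i" if "u \<in> carrier_vec m" "i < m" for u i
    unfolding L_def by (rule laplacian_mat_mult_vec[OF G(1,2) that])
  have root_iff: "r \<in># proots (char_poly L) \<longleftrightarrow> eigenvalue L r" for r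
  proof -
    have "char_poly L \<noteq> 0" using degree_monic_char_poly[OF L] by auto
    then show ?thesis by (simp add: eigenvalue_root_char_poly[OF L])
  qed
  have nonneg: "0 \<le> r" if r: "r \<in># proots (char_poly L)" for r
  proof -
    obtain u where u: "u \<in> carrier_vec m" "u \<noteq> 0\<^sub>v m" "L *\<^sub>v u = r \<cdot>\<^sub>v u"
      using r L unfolding root_iff eigenvalue_def eigenvector_def by auto
    have "lap m (adjacency G) (\<lambda>i. u $ i) i = r * u $ i" if "i < m" for i
      using L_mult[OF u(1) that] u that by simp
    then have "(\<Sum>i<m. u $ i * lap m (adjacency G) (\<lambda>i. u $ i) i) = r * (\<Sum>i<m. (u $ i)\<^sup>2)"
      by (simp add: sum_distrib_left power2_eq_square algebra_simps)
    then have "0 \<le> r * (\<Sum>i<m. (u $ i)\<^sup>2)" using energy_nonneg[of "\<lambda>i. u $ i"] by simp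
    moreover have "0 < (\<Sum>i<m. (u $ i)\<^sup>2)"
    proof -
      obtain i where "i < m" "u $ i \<noteq> 0" using u(1,2) by (metis carrier_vecD eq_vecI index_zero_vec)
      then show ?thesis by (intro sum_pos2[of _ i]) auto
    qed
    ultimately show ?thesis by (simp add: zero_le_mult_iff)
  qed
  have simple: "count (proots (char_poly L)) 0 = 1"
  proof -
    have "order 0 (char_poly L) = 1"
    proof (rule order_zero_char_poly_eq_1[OF L])
      fix j assume j: "j < m"
      have "(\<Sum>i<m. (L *\<^sub>v unit_vec m j) $ i) = 0" using sum_lap by (simp add: L_mult)
      moreover have "(L *\<^sub>v unit_vec m j) $ i = L $$ (i, j)" if "i < m" for i
        using that j carrier_matD[OF L] by (simp add: scalar_prod_right_unit)
      ultimately show "(\<Sum>i<m. L $$ (i, j)) = 0" by simp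
    next
      fix w assume w: "w \<in> carrier_vec m" "L *\<^sub>v w = 0\<^sub>v m" "(\<Sum>i<m. w $ i) = 0"
      then have "lap m (adjacency G) (\<lambda>i. w $ i) i = 0" if "i < m" for i
        using L_mult[OF w(1) that] that by simp
      then have "(\<Sum>i<m. w $ i * lap m (adjacency G) (\<lambda>i. w $ i) i) = 0" by simp
      then have "w $ i = 0" if "i < m" for i
        by (rule zero_energy_mean_zero_imp_zero[OF _ w(3) that])
      then show "w = 0\<^sub>v m" using w(1) by auto
    qed (use m in simp)
    moreover have "char_poly L \<noteq> 0" using degree_monic_char_poly[OF L] by auto
    ultimately show ?thesis by simp
  qed
  obtain w where w: "(\<Sum>i<m. w i) = 0" "(\<Sum>i<m. (w i)\<^sup>2) = 1"
    and min: "\<And>v. (\<Sum>i<m. v i) = 0 \<Longrightarrow>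
      (\<Sum>i<m. w i * lap m (adjacency G) w i) * (\<Sum>i<m. (v i)\<^sup>2) \<le> (\<Sum>i<m. v i * lap m (adjacency G) v i)"
    using rayleigh_minimizer_exists[OF m] by blast
  define \<nu> where "\<nu> = (\<Sum>i<m. w i * lap m (adjacency G) w i)"
  have lap_w: "lap m (adjacency G) w i = \<nu> * w i" if "i < m" for i
    by (rule rayleigh_minimizer_eigenvector[OF w(1) _ _ that]) (use min w in \<open>auto simp: \<nu>_def\<close>)
  have "\<nu> \<noteq> 0"
  proof
    assume "\<nu> = 0"
    then have "w i = 0" if "i < m" for i
      unfolding \<nu>_def by (rule zero_energy_mean_zero_imp_zero[OF _ w(1) that])
    then show False using w(2) by simp
  qed
  then have nu: "0 < \<nu>" using energy_nonneg[of w] by (simp add: \<nu>_def)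
  have "eigenvector L (vec m w) \<nu>"
  proof -
    have "L *\<^sub>v vec m w = \<nu> \<cdot>\<^sub>v vec m w"
    proof (rule eq_vecI)
      fix i assume "i < dim_vec (\<nu> \<cdot>\<^sub>v vec m w)"
      then have i: "i < m" by simp
      have "lap m (adjacency G) (\<lambda>i. vec m w $ i) i = lap m (adjacency G) w i"
        using i by (simp add: lap_def)
      then show "(L *\<^sub>v vec m w) $ i = (\<nu> \<cdot>\<^sub>v vec m w) $ i"
        using i L_mult[of "vec m w" i] by (simp add: lap_w)
    qed (use carrier_matD[OF L] in simp)
    moreover have "vec m w \<noteq> 0\<^sub>v m"
    proof
      assume "vec m w = 0\<^sub>v m"
      then have "w i = 0" if "i < m" for i using that by (metis index_vec index_zero_vec(1))
      then show False using w(2) by simp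
    qed
    ultimately show ?thesis using carrier_matD[OF L] by (simp add: eigenvector_def)
  qed
  then have "\<nu> \<in># proots (char_poly L)" using root_iff by (auto simp: eigenvalue_def)
  note second = second_of_sorted_list_of_multiset[OF nonneg simple this nu]
  show "0 < \<mu>" using second(1)
    by (simp add: \<mu>_def second_smallest_eigenvalue_def sorted_eigenvalues_def L_def)
  assume v: "(\<Sum>i<m. v i) = 0"
  have "\<mu> \<le> \<nu>" using second(2)
    by (simp add: \<mu>_def second_smallest_eigenvalue_def sorted_eigenvalues_def L_def)
  then have "\<mu> * (\<Sum>i<m. (v i)\<^sup>2) \<le> \<nu> * (\<Sum>i<m. (v i)\<^sup>2)"
    by (intro mult_right_mono sum_nonneg) auto
  also have "\<dots> \<le> (\<Sum>i<m. v i * lap m (adjacency G) v i)"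
    using min[OF v] by (simp add: \<nu>_def)
  finally show "\<mu> * (\<Sum>i<m. (v i)\<^sup>2) \<le> (\<Sum>i<m. v i * lap m (adjacency G) v i)" .
qed

section \<open>The lower bound for the smallest entry\<close>

theorem lemma1:
  fixes n s :: nat
    and G :: "(nat, 'b) pre_digraph"
    and \<alpha> :: "nat \<Rightarrow> real"
    and x :: "real vec"
  assumes "0 < n" and "0 < s" and "2 \<le> n - s"
    and "Digraph.graph G" and "verts G = {0..<n - s}" and "Digraph_Component.connected G"
    and "\<And>i. i < n - s \<Longrightarrow> 0 \<le> \<alpha> i \<and> \<alpha> i \<le> real s"
    and "eigenvector (laplacian_mat (n - s) G + mat_diag (n - s) \<alpha>) x
           (smallest_eigenvalue (laplacian_mat (n - s) G + mat_diag (n - s) \<alpha>))"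
    and "\<And>i. i < n - s \<Longrightarrow> 0 < x $ i"
    and "linf_norm x = 1"
  shows "Min (set\<^sub>v x) \<ge>
    1 - 2 * sqrt (real s * (\<Sum>i<n - s. \<alpha> i)) / second_smallest_eigenvalue (laplacian_mat (n - s) G)"
proof -
  define m where "m = n - s"
  define L where "L = laplacian_mat m G"
  define lam where "lam = smallest_eigenvalue (L + mat_diag m \<alpha>)"
  define \<mu> where "\<mu> = second_smallest_eigenvalue L"
  have m: "2 \<le> m" and G: "Digraph.graph G" "verts G = {0..<m}" "Digraph_Component.connected G"
    and al: "\<And>i. i < m \<Longrightarrow> 0 \<le> \<alpha> i" "\<And>i. i < m \<Longrightarrow> \<alpha> i \<le> real s"
    and pos: "\<And>i. i < m \<Longrightarrow> 0 < x $ i"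
    using assms(3-7,9) by (simp_all add: m_def)
  interpret connected_weighted_graph m "adjacency G"
    by (rule connected_weighted_graph_adjacency[OF G])
  have L [simp]: "L \<in> carrier_mat m m" by (simp add: L_def)
  have x: "x \<in> carrier_vec m" and Ax: "(L + mat_diag m \<alpha>) *\<^sub>v x = lam \<cdot>\<^sub>v x"
    using assms(8) unfolding m_def[symmetric] L_def[symmetric] lam_def[symmetric]
    by (auto simp: eigenvector_def mat_diag_def)
  have dimx: "dim_vec x = m" using x by simp
  have eig: "lap m (adjacency G) (\<lambda>i. x $ i) i + \<alpha> i * x $ i = lam * x $ i" if i: "i < m" for i
  proof -
    have "(mat_diag m \<alpha> *\<^sub>v x) $ i = (\<Sum>j<m. (if i = j then \<alpha> j else 0) * x $ j)"
      using i dimx by (simp add: mat_diag_def scalar_prod_def lessThan_atLeast0)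
    also have "\<dots> = (\<Sum>j<m. if i = j then \<alpha> j * x $ j else 0)"
      by (rule sum.cong) auto
    also have "\<dots> = \<alpha> i * x $ i" using i by simp
    finally have "(mat_diag m \<alpha> *\<^sub>v x) $ i = \<alpha> i * x $ i" .
    moreover have "(L + mat_diag m \<alpha>) *\<^sub>v x = L *\<^sub>v x + mat_diag m \<alpha> *\<^sub>v x"
      by (rule add_mult_distrib_mat_vec[OF L mat_diag_dim x])
    then have "(L *\<^sub>v x) $ i + (mat_diag m \<alpha> *\<^sub>v x) $ i = lam * x $ i"
      using arg_cong[OF Ax, of "\<lambda>v. v $ i"] i dimx by (simp add: mat_diag_def)
    ultimately show ?thesis using laplacian_mat_mult_vec[OF G(1,2) x i] by (simp add: L_def)
  qed
  have set_x: "set\<^sub>v x = (\<lambda>i. x $ i) ` {..<m}" by (simp add: vec_set_def dimx)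
  have fin: "finite (set\<^sub>v x)" and ne: "set\<^sub>v x \<noteq> {}" using m by (auto simp: set_x lessThan_empty_iff)
  have "Max (abs ` set\<^sub>v x) = 1" using assms(10) by (simp add: linf_norm_def)
  then have "1 \<in> abs ` set\<^sub>v x" and le: "\<And>y. y \<in> set\<^sub>v x \<Longrightarrow> \<bar>y\<bar> \<le> 1"
    using Max_in[of "abs ` set\<^sub>v x"] Max_ge[of "abs ` set\<^sub>v x"] fin ne by auto
  then obtain k where k: "k < m" "x $ k = 1"
    using pos by (force simp: set_x)
  have le1: "x $ i \<le> 1" if "i < m" for i using le[of "x $ i"] that by (auto simp: set_x)
  obtain l where l: "l < m" "Min (set\<^sub>v x) = x $ l" using Min_in[OF fin ne] by (auto simp: set_x)
  have "x $ k - x $ l \<le> 2 * sqrt (real s * (\<Sum>i<m. \<alpha> i)) / \<mu>"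
    by (rule spread_le_of_gap[where lam = lam])
      (use second_smallest_eigenvalue_laplacian[OF m G] eig pos le1 al k l in \<open>auto simp: \<mu>_def L_def\<close>)
  then show ?thesis using k l by (simp add: \<mu>_def L_def m_def)
qed

end
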